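(* Let $\mathcal{E}$ be a non-trivial finite-dimensional Volterra evolution algebra over a field $\mathbb{K}$ of characteristic zero. Then $\mathcal{E}$ is not nilpotent.
   Context: An evolution algebra over $\mathbb{K}$ is a finite-dimensional $\mathbb{K}$-vector space $\mathcal{E}$ with a bilinear multiplication and a basis $\{e_1,\dots,e_n\}$ (called a natural basis) such that $e_ie_j=0$ for $i\neq j$ and $e_i^2=\sum_{k=1}^n a_{ik}e_k$. The matrix $A=(a_{ij})_{i,j=1}^n$ is the structural matrix of $\mathcal{E}$ in this natural basis. The evolution algebra is called a Volterra evolution algebra if $A$ is skew-symmetric ($a_{ij}=-a_{ji}$ for all $i,j$). It is non-trivial if its multiplication is not identically zero, i.e. $A\neq 0$. For an algebra $\mathcal{E}$ put $\mathcal{E}^1=\mathcal{E}$ and $\mathcal{E}^{k+1}=\sum_{i=1}^{k}\mathcal{E}^i\mathcal{E}^{k+1-i}$, where a product of subspaces is the linear span of the products of their elements. The algebra $\mathcal{E}$ is nilpotent if $\mathcal{E}^n=0$ for some $n\in\mathbb{N}$. *)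

theory Defs
  imports Complex_Main "HOL-Library.Set_Algebras"
begin

text \<open>The underlying vector space is the whole type \<open>'v\<close>, with scalar multiplication \<open>scale\<close>.\<close>

locale nonassoc_algebra = vector_space scale
  for scale :: "'k::field \<Rightarrow> 'v::ab_group_add \<Rightarrow> 'v" (infixr \<open>*s\<close> 75) +
  fixes mult :: "'v \<Rightarrow> 'v \<Rightarrow> 'v" (infixl \<open>\<bullet>\<close> 70)
  assumes linear_mult_left: "\<And>y. Vector_Spaces.linear (*s) (*s) (\<lambda>x. x \<bullet> y)"
    and linear_mult_right: "\<And>x. Vector_Spaces.linear (*s) (*s) (\<lambda>y. x \<bullet> y)"
begin

definition subspace_prod :: "'v set \<Rightarrow> 'v set \<Rightarrow> 'v set" where
  "subspace_prod S T = span {x \<bullet> y | x y. x \<in> S \<and> y \<in> T}"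

text \<open>The outer sum is the sum of subspaces (elementwise addition of sets, from
  \<^theory>\<open>HOL-Library.Set_Algebras\<close>). The value at exponent 0 is a dummy that is never used.\<close>

fun alg_power :: "nat \<Rightarrow> 'v set" where
  "alg_power 0 = UNIV"
| "alg_power (Suc 0) = UNIV"
| "alg_power (Suc (Suc k)) =
     (\<Sum>i\<in>{1..Suc k}. subspace_prod (alg_power i) (alg_power (Suc (Suc k) - i)))"

definition nilpotent :: bool where
  "nilpotent \<longleftrightarrow> (\<exists>n\<ge>1. alg_power n = {0})"

definition natural_basis :: "nat \<Rightarrow> (nat \<Rightarrow> 'v) \<Rightarrow> bool" where
  "natural_basis n e \<longleftrightarrow>
     inj_on e {1..n} \<and> independent (e ` {1..n}) \<and> span (e ` {1..n}) = UNIV \<and>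
     (\<forall>i\<in>{1..n}. \<forall>j\<in>{1..n}. i \<noteq> j \<longrightarrow> e i \<bullet> e j = 0)"

text \<open>Only the entries of \<open>A\<close> with indices in \<open>{1..n}\<close> are meaningful.\<close>

definition structural_matrix :: "nat \<Rightarrow> (nat \<Rightarrow> 'v) \<Rightarrow> (nat \<Rightarrow> nat \<Rightarrow> 'k) \<Rightarrow> bool" where
  "structural_matrix n e A \<longleftrightarrow>
     (\<forall>i\<in>{1..n}. e i \<bullet> e i = (\<Sum>k\<in>{1..n}. A i k *s e k))"

end

locale evolution_algebra = nonassoc_algebra +
  assumes ex_natural_basis: "\<exists>n e. natural_basis n e"

locale volterra_evolution_algebra = evolution_algebra +
  assumes ex_skew_symmetric: "\<exists>n e A. natural_basis n e \<and> structural_matrix n e A \<and>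
    (\<forall>i\<in>{1..n}. \<forall>j\<in>{1..n}. A i j = - A j i)"

end

theory Submission imports Defs begin

text \<open>
  Choose \<open>i\<close> with \<open>u = e\<^sub>i\<^sup>2 \<noteq> 0\<close> and \<open>j\<close> with \<open>a\<^sub>i\<^sub>j \<noteq> 0\<close>, and put \<open>v = e\<^sub>j\<^sup>2\<close>. Then \<open>a\<^sub>j\<^sub>i \<noteq> 0\<close>
  by skew-symmetry. Since \<open>u e\<^sub>j = a\<^sub>i\<^sub>j v\<close> and \<open>v e\<^sub>i = a\<^sub>j\<^sub>i u\<close>, each of \<open>u\<close> and \<open>v\<close> is a multiple
  of the other one, so both lie in every power of the algebra.
\<close>

context nonassoc_algebra
begin

lemma mult_sum_left: "(\<Sum>k\<in>I. f k) \<bullet> y = (\<Sum>k\<in>I. f k \<bullet> y)"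
proof -
  interpret Vector_Spaces.linear scale scale "\<lambda>x. x \<bullet> y"
    by (rule linear_mult_left)
  show ?thesis
    by (rule sum)
qed

lemma mult_scale_left: "(c *s x) \<bullet> y = c *s (x \<bullet> y)"
  using linear_mult_left[of y] by (simp add: Vector_Spaces.linear_iff)

lemma mult_scale_right: "x \<bullet> (c *s y) = c *s (x \<bullet> y)"
  using linear_mult_right[of x] by (simp add: Vector_Spaces.linear_iff)

text \<open>Linear extension in one argument at a time: first in \<open>y\<close> for
  \<open>x\<close> in \<open>B\<close>, then in \<open>x\<close> for arbitrary
  \<open>y\<close>.\<close>

lemma mult_eq_0_if_eq_0_on_basis:
  assumes "span B = UNIV" and "\<And>x y. x \<in> B \<Longrightarrow> y \<in> B \<Longrightarrow> x \<bullet> y = 0"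
  shows "x \<bullet> y = 0"
proof -
  interpret vector_space_pair scale scale ..
  have right: "x \<bullet> y = 0" if "x \<in> B" for x y
    using linear_eq_0_on_span[OF linear_mult_right, of B x y] assms that by auto
  show ?thesis
    using linear_eq_0_on_span[OF linear_mult_left, of B y x] assms(1) right by auto
qed

text \<open>The last summand of \<open>alg_power (Suc k)\<close> is the product of
  \<open>alg_power k\<close> with the first power \<open>UNIV\<close>, so any right factor is
  allowed.\<close>

lemma mult_in_alg_power_Suc:
  assumes "k \<ge> 1" and "x \<in> alg_power k"
  shows "x \<bullet> y \<in> alg_power (Suc k)"
proof -
  obtain l where k: "k = Suc l"
    using assms(1) by (cases k) auto
  let ?S = "\<lambda>i. subspace_prod (alg_power i) (alg_power (Suc (Suc l) - i))"
  \<comment> \<open>Members of a sum of sets are sums of chosen members: here the product in the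
    last summand, and 0, which lies in every span, elsewhere.\<close>
  let ?s = "\<lambda>i. if i = Suc l then x \<bullet> y else 0"
  have "?s i \<in> ?S i" for i
    using assms(2) k by (auto simp: subspace_prod_def span_zero intro!: span_base)
  moreover have "(\<Sum>i\<in>{1..Suc l}. ?s i) = x \<bullet> y"
    by (subst sum.delta) auto
  ultimately have "x \<bullet> y \<in> (\<Sum>i\<in>{1..Suc l}. ?S i)"
    unfolding set_sum_alt[OF finite_atLeastAtMost]
    by (intro CollectI exI[of _ ?s] conjI ballI) (rule sym)
  then show ?thesis
    using k by simp
qed

text \<open>In the expansion of the square, multiplication by \<open>e j\<close> kills every term
  except the one at \<open>j\<close>.\<close>

lemma square_mult_natural_basis:
  assumes "natural_basis n e" and "structural_matrix n e A"
    and "i \<in> {1..n}" and "j \<in> {1..n}"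
  shows "(e i \<bullet> e i) \<bullet> e j = A i j *s (e j \<bullet> e j)"
proof -
  have "(e i \<bullet> e i) \<bullet> e j = (\<Sum>k\<in>{1..n}. A i k *s (e k \<bullet> e j))"
    using assms(2,3) by (simp add: structural_matrix_def mult_sum_left mult_scale_left)
  also have "\<dots> = (\<Sum>k\<in>{1..n}. if k = j then A i j *s (e j \<bullet> e j) else 0)"
    using assms(1,4) by (intro sum.cong) (auto simp: natural_basis_def)
  also have "\<dots> = A i j *s (e j \<bullet> e j)"
    using assms(4) by simp
  finally show ?thesis .
qed

lemma not_nilpotent_if_mutual_multiples:
  assumes "u \<noteq> 0" and "u \<bullet> y = v" and "v \<bullet> z = u"
  shows "\<not> nilpotent"
proof -
  \<comment> \<open>Both memberships are carried at once: \<open>u\<close> in one power puts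
    \<open>v\<close> into the next, and vice versa.\<close>
  have "u \<in> alg_power n \<and> v \<in> alg_power n" if "n \<ge> 1" for n
    using that
  proof (induction n rule: dec_induct)
    case base
    then show ?case by simp
  next
    case (step n)
    then show ?case
      using mult_in_alg_power_Suc[of n u y] mult_in_alg_power_Suc[of n v z] assms(2,3) by simp
  qed
  then show ?thesis
    using assms(1) by (auto simp: nilpotent_def)
qed

end

theorem theorem4p4:
  fixes scale :: "'k::field_char_0 \<Rightarrow> 'v::ab_group_add \<Rightarrow> 'v"
    and mult :: "'v \<Rightarrow> 'v \<Rightarrow> 'v"
  assumes "volterra_evolution_algebra scale mult"
    and "\<exists>x y. mult x y \<noteq> 0"
  shows "\<not> nonassoc_algebra.nilpotent scale mult"
proof -
  interpret volterra_evolution_algebra scale mult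
    by (rule assms(1))
  obtain n e A where nb: "natural_basis n e" and sm: "structural_matrix n e A"
    and skew: "\<And>i j. i \<in> {1..n} \<Longrightarrow> j \<in> {1..n} \<Longrightarrow> A i j = - A j i"
    using ex_skew_symmetric by blast
  \<comment> \<open>If all squares vanished, so would all products of basis vectors, and hence the
    multiplication.\<close>
  have "\<exists>i\<in>{1..n}. mult (e i) (e i) \<noteq> 0"
  proof (rule ccontr)
    assume "\<not> ?thesis"
    then have "mult (e k) (e l) = 0" if "k \<in> {1..n}" "l \<in> {1..n}" for k l
      using nb that by (cases "k = l") (auto simp: natural_basis_def)
    then have basis_0: "mult x y = 0" if "x \<in> e ` {1..n}" "y \<in> e ` {1..n}" for x y
      using that by blast
    have "span (e ` {1..n}) = UNIV"
      using nb unfolding natural_basis_def by blast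
    then have "mult x y = 0" for x y
      by (rule mult_eq_0_if_eq_0_on_basis) (rule basis_0)
    then show False
      using assms(2) by simp
  qed
  then obtain i where i: "i \<in> {1..n}" "mult (e i) (e i) \<noteq> 0"
    by blast
  then have "(\<Sum>k\<in>{1..n}. scale (A i k) (e k)) \<noteq> 0"
    using sm by (simp add: structural_matrix_def)
  then obtain j where "j \<in> {1..n}" "scale (A i j) (e j) \<noteq> 0"
    by (rule sum.not_neutral_contains_not_neutral)
  then have j: "j \<in> {1..n}" "A i j \<noteq> 0"
    by auto
  then have ji: "A j i \<noteq> 0"
    using skew[OF i(1) j(1)] by auto
  show ?thesis
  proof (rule not_nilpotent_if_mutual_multiples[OF i(2)])
    \<comment> \<open>The inverse cancels the coefficient \<open>A i j\<close> that multiplication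
      by \<open>e j\<close> produces; likewise below with \<open>A j i\<close>.\<close>
    show "mult (mult (e i) (e i)) (scale (inverse (A i j)) (e j)) = mult (e j) (e j)"
      using square_mult_natural_basis[OF nb sm i(1) j(1)] j(2) by (simp add: mult_scale_right)
    show "mult (mult (e j) (e j)) (scale (inverse (A j i)) (e i)) = mult (e i) (e i)"
      using square_mult_natural_basis[OF nb sm j(1) i(1)] ji by (simp add: mult_scale_right)
  qed
qed

end
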